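(* Let $F$ be a finite field, let $a_0,a_1,a_2,\dots$ and $b_1,b_2,\dots$ be sequences in $F$, let $\mathcal{A}_n$ ($n\ge 0$) be the associated Toeplitz matrices and let $\nu=\{\nu_n\}_{n\ge 0}$ be the corresponding nullity sequence. Then $\nu$ has one of the following forms. (1) $\nu=\{1,2,\dots,d-1,d,d,d,\dots\}$ for some positive integer $d$. (2) $\nu=\{0,1,2,\dots\}$. (3) $\nu=\{1,2,3,\dots\}$. (4) $\nu$ is the concatenation of finite length strings, each of one of the following forms: (a) an arbitrary number of zeroes; (b) $1,2,\dots,d-1,d,d-1,\dots,2,1,0$ for some positive integer $d\ge 1$; (c) $1,2,\dots,d-1,d,d,\dots,d,d-1,\dots,2,1,0$, where $d\ge 1$ may appear an arbitrary (finite) number of times. (5) $\nu$ is the concatenation of a finite number of finite length strings of the forms (a), (b), (c) in (4), followed by a sequence of the form in (1) or in (3).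
   Context: Given sequences $a_0,a_1,\dots$ and $b_1,b_2,\dots$ in $F$, for each integer $n\ge 0$ the matrix $\mathcal{A}_n$ is the $(n+1)\times(n+1)$ Toeplitz matrix whose $(i,j)$ entry ($0\le i,j\le n$) is $a_{j-i}$ if $j\ge i$ and $b_{i-j}$ if $i>j$. The nullity sequence is defined by $\nu_n=\dim\ker(\mathcal{A}_n)$, where $\ker$ denotes the right kernel in the space of column vectors $F^{n+1}$. *)

theory Defs
  imports "HOL-Library.Stream" "Jordan_Normal_Form.Matrix_Kernel"
begin

text \<open>The sequence \<open>b\<close> is indexed from \<open>1\<close>: the value \<open>b 0\<close> is never used.\<close>

definition toeplitz_mat :: "(nat \<Rightarrow> 'a) \<Rightarrow> (nat \<Rightarrow> 'a) \<Rightarrow> nat \<Rightarrow> 'a mat" where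
  "toeplitz_mat a b n =
     mat (n + 1) (n + 1) (\<lambda>(i, j). if i \<le> j then a (j - i) else b (i - j))"

definition nullity_seq :: "(nat \<Rightarrow> 'a::field) \<Rightarrow> (nat \<Rightarrow> 'a) \<Rightarrow> nat stream" where
  "nullity_seq a b = smap (\<lambda>n. kernel_dim (toeplitz_mat a b n)) nats"

definition zero_string :: "nat list \<Rightarrow> bool" where
  "zero_string s \<longleftrightarrow> (\<exists>k\<ge>1. s = replicate k 0)"

definition peak_string :: "nat list \<Rightarrow> bool" where
  "peak_string s \<longleftrightarrow> (\<exists>d\<ge>1. s = [1..<d] @ [d] @ rev [0..<d])"

definition plateau_string :: "nat list \<Rightarrow> bool" where
  "plateau_string s \<longleftrightarrow> (\<exists>d\<ge>1. \<exists>k\<ge>1. s = [1..<d] @ replicate k d @ rev [0..<d])"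

text \<open>All strings allowed here are nonempty, so that \<^const>\<open>flat\<close> applied to a stream of
  them is their concatenation.\<close>

definition nullity_string :: "nat list \<Rightarrow> bool" where
  "nullity_string s \<longleftrightarrow> zero_string s \<or> peak_string s \<or> plateau_string s"

definition eventually_const_form :: "nat stream \<Rightarrow> bool" where
  "eventually_const_form \<nu> \<longleftrightarrow> (\<exists>d\<ge>1. \<nu> = [1..<d] @- sconst d)"

end

theory Submission
  imports Defs "HOL-Library.Cardinality" "HOL-Computational_Algebra.Polynomial"
begin

text \<open>Write \<open>t k\<close> for the entry on the \<open>k\<close>-th diagonal of the Toeplitz matrices, and read a column
  vector as the coefficients of a polynomial of degree at most \<open>n\<close>. Then \<open>ker \<A>\<^sub>n\<close> becomes the
  space \<open>K n\<close> of polynomials \<open>p\<close> of degree at most \<open>n\<close> whose moments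
  \<open>L(x^k p) = \<Sum>j. p\<^sub>j t (j + k)\<close> vanish for \<open>-n \<le> k \<le> 0\<close>. All these spaces live inside one
  polynomial ring, so \<open>K (n + 1)\<close> can be compared with both \<open>K n\<close> and \<open>x K n\<close>. The intersection with
  either of them is cut out by one linear functional, in \<open>K (n + 1)\<close> as well as in the other
  space. Hence consecutive nullities differ by at most one.

  Two further ingredients determine the shape of the sequence. A nonzero finite-dimensional space
  \<open>K\<close> is never contained in \<open>x K\<close>, because one could divide by \<open>x\<close> forever. And
  \<open>\<Sum>i. p\<^sub>i L(x^(i+k) q) = L(x^k p q)\<close> is symmetric in \<open>p\<close> and \<open>q\<close> (\<open>moment_pairing_commute\<close>); this
  plays the role that the left kernel would play in an argument with ranks. Together they show that
  a rise to a value above one was preceded by a rise (\<open>growth_persists_backwards\<close>), so a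
  plateau or a descent cannot turn upwards before reaching zero, and that a descent, once begun,
  goes down by one at every step until it reaches zero (\<open>descent_persists\<close>).

  The rest is about sequences of natural numbers. A sequence with these properties that starts
  with a zero or a one either is \<open>1, 2, 3, \<dots>\<close>, or becomes constant after an initial rise, or begins with one
  of the allowed strings and continues with a sequence of the same kind
  (\<open>first_string_or_tail\<close>). Peeling off strings either stops, giving a finite, possibly empty, concatenation
  followed by a tail, or goes on forever, giving an infinite concatenation.

  Dimensions are compared by counting: over a field with \<open>q\<close> elements, \<open>K n\<close> has
  \<open>q ^ \<nu> n\<close> elements, and a hyperplane of it has \<open>q\<close> times fewer.\<close>

section \<open>Counting in vector spaces over finite fields\<close>

lemma (in vectorspace) card_carrier_eq_power_dim:
  assumes "finite (carrier V)"
  shows "card (carrier V) = card (carrier K) ^ dim"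
proof -
  have "gen_set (carrier V)"
    using in_own_span[of "carrier V"] span_is_subset2[of "carrier V"] by blast
  hence "fin_dim"
    unfolding fin_dim_def using assms by blast
  then obtain B where B: "finite B" "basis B"
    using finite_basis_exists by blast
  hence BV: "B \<subseteq> carrier V"
    by (auto simp: basis_def)
  have "bij_betw (\<lambda>c. lincomb c B) (B \<rightarrow>\<^sub>E carrier K) (carrier V)"
    unfolding bij_betw_def
  proof
    have uniq: "\<And>v. v \<in> carrier V \<Longrightarrow> \<exists>!c. c \<in> B \<rightarrow>\<^sub>E carrier K \<and> lincomb c B = v"
      using basis_criterion[of B] B BV by blast
    have closed: "\<And>c. c \<in> B \<rightarrow>\<^sub>E carrier K \<Longrightarrow> lincomb c B \<in> carrier V"
      using BV by (intro lincomb_closed) (auto simp: PiE_def)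
    show "inj_on (\<lambda>c. lincomb c B) (B \<rightarrow>\<^sub>E carrier K)"
      using uniq closed unfolding inj_on_def by metis
    show "(\<lambda>c. lincomb c B) ` (B \<rightarrow>\<^sub>E carrier K) = carrier V"
      using uniq closed by (auto simp: image_iff) metis
  qed
  hence "card (carrier V) = card (B \<rightarrow>\<^sub>E carrier K)"
    by (simp add: bij_betw_same_card)
  thus ?thesis
    using B by (simp add: card_PiE dim_basis)
qed

lemma finite_carrier_vec: "finite (carrier_vec n :: 'a :: finite vec set)"
proof (rule finite_subset)
  show "carrier_vec n \<subseteq> vec_of_list ` {xs :: 'a list. set xs \<subseteq> UNIV \<and> length xs = n}"
  proof
    fix v :: "'a vec" assume "v \<in> carrier_vec n"
    thus "v \<in> vec_of_list ` {xs. set xs \<subseteq> UNIV \<and> length xs = n}"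
      by (intro image_eqI[of _ _ "list_of_vec v"]) (auto simp: vec_list)
  qed
qed (use finite_lists_length_eq[of "UNIV :: 'a set" n] in simp)

lemma card_mat_kernel:
  fixes A :: "'a :: {finite, field} mat"
  assumes "A \<in> carrier_mat nr nc"
  shows "card (mat_kernel A) = CARD('a) ^ kernel_dim A"
proof -
  interpret kernel nr nc A using assms by unfold_locales
  have "finite (mat_kernel A)"
    using mat_kernel_carrier[OF assms] finite_carrier_vec finite_subset by blast
  thus ?thesis
    using Ker.card_carrier_eq_power_dim by simp
qed

text \<open>The fibres of a nonzero functional are translates of its zero set, and there is one fibre for each
  element of the field.\<close>

lemma card_eq_card_field_times_card_hyperplane:
  fixes scale :: "'a :: {finite, field} \<Rightarrow> 'b :: ab_group_add \<Rightarrow> 'b" and \<phi> :: "'b \<Rightarrow> 'a"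
  assumes lin: "Vector_Spaces.linear scale (*) \<phi>"
    and sub: "module.subspace scale U" and fin: "finite U"
    and u: "u \<in> U" "\<phi> u \<noteq> 0"
  shows "card U = CARD('a) * card {x \<in> U. \<phi> x = 0}"
proof -
  interpret Vector_Spaces.linear scale "(*)" \<phi> by (rule lin)
  have fibre: "card {x \<in> U. \<phi> x = c} = card {x \<in> U. \<phi> x = 0}" for c
  proof -
    define w where "w = scale (c / \<phi> u) u"
    have w: "w \<in> U" "\<phi> w = c"
      using u by (auto simp: w_def scale intro: vs1.subspace_scale[OF sub])
    have "bij_betw (\<lambda>x. x + w) {x \<in> U. \<phi> x = 0} {x \<in> U. \<phi> x = c}"
      by (rule bij_betw_byWitness[where f' = "\<lambda>x. x - w"])
         (use w in \<open>auto simp: add diff intro: vs1.subspace_add[OF sub] vs1.subspace_diff[OF sub]\<close>)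
    thus ?thesis by (simp add: bij_betw_same_card)
  qed
  have "card U = card (\<Union>c. {x \<in> U. \<phi> x = c})"
    by (rule arg_cong[of _ _ card]) auto
  also have "\<dots> = (\<Sum>c\<in>UNIV. card {x \<in> U. \<phi> x = c})"
    using fin by (intro card_UN_disjoint) auto
  also have "\<dots> = (\<Sum>c\<in>(UNIV :: 'a set). card {x \<in> U. \<phi> x = 0})"
    by (intro sum.cong refl fibre)
  also have "\<dots> = CARD('a) * card {x \<in> U. \<phi> x = 0}"
    by simp
  finally show ?thesis .
qed

section \<open>Toeplitz kernels as spaces of polynomials\<close>

definition toeplitz_diagonal :: "(nat \<Rightarrow> 'a) \<Rightarrow> (nat \<Rightarrow> 'a) \<Rightarrow> int \<Rightarrow> 'a" where
  "toeplitz_diagonal a b k = (if k \<ge> 0 then a (nat k) else b (nat (- k)))"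

text \<open>This is \<open>L(x^k p)\<close> for the linear functional \<open>L\<close> on Laurent polynomials with \<open>L(x^j) = t j\<close>.\<close>

definition moment :: "(int \<Rightarrow> 'a :: comm_semiring_1) \<Rightarrow> int \<Rightarrow> 'a poly \<Rightarrow> 'a" where
  "moment t k p = (\<Sum>j\<le>degree p. coeff p j * t (int j + k))"

definition toeplitz_kernel :: "(int \<Rightarrow> 'a :: comm_semiring_1) \<Rightarrow> nat \<Rightarrow> 'a poly set" where
  "toeplitz_kernel t n = {p. degree p \<le> n \<and> (\<forall>k\<in>{- int n..0}. moment t k p = 0)}"

lemma moment_eq_sum:
  assumes "degree p \<le> N"
  shows "moment t k p = (\<Sum>j\<le>N. coeff p j * t (int j + k))"
  unfolding moment_def using assms
  by (intro sum.mono_neutral_left) (auto simp: coeff_eq_0)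

lemma moment_pCons: "moment t k (pCons 0 p) = moment t (k + 1) p"
proof -
  have "moment t k (pCons 0 p) = (\<Sum>j\<le>Suc (degree p). coeff (pCons 0 p) j * t (int j + k))"
    by (rule moment_eq_sum) (rule degree_pCons_le)
  also have "\<dots> = moment t (k + 1) p"
    by (simp add: sum.atMost_Suc_shift moment_def algebra_simps del: sum.atMost_Suc)
  finally show ?thesis .
qed

lemma moment_0 [simp]: "moment t k 0 = 0"
  by (simp add: moment_def)

lemma moment_add: "moment t k (p + q) = moment t k p + moment t k q"
proof -
  define N where "N = max (degree p) (degree q)"
  have "degree p \<le> N" "degree q \<le> N" "degree (p + q) \<le> N"
    unfolding N_def by (auto intro: degree_add_le)
  thus ?thesis
    by (simp add: moment_eq_sum[of _ N] sum.distrib distrib_right)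
qed

lemma moment_smult: "moment t k (Polynomial.smult c p) = c * moment t k p"
  by (subst moment_eq_sum[of "Polynomial.smult c p" "degree p"])
    (simp_all add: degree_smult_le moment_def sum_distrib_left mult.assoc)

text \<open>Both sides equal \<open>L(x^k p q)\<close>. This symmetry is how a vector in one kernel puts a linear constraint
  on the moments of a vector in another one.\<close>

lemma moment_pairing_commute:
  assumes "degree p \<le> M" "degree q \<le> N"
  shows "(\<Sum>i\<le>M. coeff p i * moment t (int i + k) q) = (\<Sum>j\<le>N. coeff q j * moment t (int j + k) p)"
proof -
  have "(\<Sum>i\<le>M. coeff p i * moment t (int i + k) q)
      = (\<Sum>i\<le>M. \<Sum>j\<le>N. coeff p i * (coeff q j * t (int j + (int i + k))))"
    using assms by (simp add: moment_eq_sum[of q N] sum_distrib_left)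
  also have "\<dots> = (\<Sum>j\<le>N. \<Sum>i\<le>M. coeff p i * (coeff q j * t (int j + (int i + k))))"
    by (rule sum.swap)
  also have "\<dots> = (\<Sum>j\<le>N. coeff q j * moment t (int j + k) p)"
    using assms by (simp add: moment_eq_sum[of p M] sum_distrib_left mult_ac add_ac)
  finally show ?thesis .
qed

lemma vector_space_poly: "vector_space (Polynomial.smult :: 'a :: field \<Rightarrow> _)"
  by unfold_locales (auto simp: smult_add_right smult_add_left)

lemma linear_moment: "Vector_Spaces.linear Polynomial.smult (*) (moment t k :: 'a :: field poly \<Rightarrow> 'a)"
  unfolding Vector_Spaces.linear_iff
  by (auto simp: vector_space_poly moment_add moment_smult) (unfold_locales; simp add: algebra_simps)

lemma linear_coeff: "Vector_Spaces.linear Polynomial.smult (*) (\<lambda>p :: 'a :: field poly. coeff p i)"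
  unfolding Vector_Spaces.linear_iff
  by (auto simp: vector_space_poly) (unfold_locales; simp add: algebra_simps)

lemma subspace_toeplitz_kernel:
  "module.subspace Polynomial.smult (toeplitz_kernel t n :: 'a :: field poly set)"
proof -
  interpret vector_space "Polynomial.smult :: 'a \<Rightarrow> _" by (rule vector_space_poly)
  show ?thesis
    by (auto simp: subspace_def toeplitz_kernel_def moment_add moment_smult
        intro: degree_add_le order_trans[OF degree_smult_le])
qed

text \<open>The \<open>i\<close>-th coordinate of \<open>\<A>\<^sub>n p\<close> is the moment of \<open>p\<close> at \<open>-i\<close>.\<close>

lemma bij_betw_toeplitz_kernel:
  fixes a b :: "nat \<Rightarrow> 'a :: field"
  shows "bij_betw (\<lambda>p. vec (Suc n) (coeff p))
    (toeplitz_kernel (toeplitz_diagonal a b) n) (mat_kernel (toeplitz_mat a b n))"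
proof -
  let ?t = "toeplitz_diagonal a b" and ?A = "toeplitz_mat a b n"
  have A: "?A \<in> carrier_mat (Suc n) (Suc n)"
    by (simp add: toeplitz_mat_def)
  have row: "(?A *\<^sub>v vec (Suc n) (coeff p)) $ i = moment ?t (- int i) p"
    if "i \<le> n" "degree p \<le> n" for p i
  proof -
    have "(?A *\<^sub>v vec (Suc n) (coeff p)) $ i
        = (\<Sum>j\<le>n. (if i \<le> j then a (j - i) else b (i - j)) * coeff p j)"
      using that by (simp add: toeplitz_mat_def scalar_prod_def atLeast0LessThan lessThan_Suc_atMost)
    also have "\<dots> = (\<Sum>j\<le>n. coeff p j * ?t (int j + - int i))"
      by (intro sum.cong refl) (auto simp: toeplitz_diagonal_def nat_diff_distrib)
    finally show ?thesis
      by (simp add: moment_eq_sum[OF \<open>degree p \<le> n\<close>])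
  qed
  have iff: "vec (Suc n) (coeff p) \<in> mat_kernel ?A \<longleftrightarrow> p \<in> toeplitz_kernel ?t n"
    if "degree p \<le> n" for p
  proof -
    have "vec (Suc n) (coeff p) \<in> mat_kernel ?A \<longleftrightarrow> (\<forall>i\<le>n. moment ?t (- int i) p = 0)"
      using A that row by (auto simp: mat_kernel[OF A] vec_eq_iff less_Suc_eq_le)
    also have "\<dots> \<longleftrightarrow> (\<forall>k\<in>{- int n..0}. moment ?t k p = 0)"
    proof safe
      fix k assume *: "\<forall>i\<le>n. moment ?t (- int i) p = 0" "k \<in> {- int n..0}"
      thus "moment ?t k p = 0" by (auto dest!: spec[of _ "nat (- k)"])
    qed auto
    finally show ?thesis
      using that by (simp add: toeplitz_kernel_def)
  qed
  show ?thesis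
    unfolding bij_betw_def
  proof
    show "inj_on (\<lambda>p. vec (Suc n) (coeff p)) (toeplitz_kernel ?t n)"
    proof (intro inj_onI poly_eqI)
      fix p q i
      assume pq: "p \<in> toeplitz_kernel ?t n" "q \<in> toeplitz_kernel ?t n"
        and eq: "vec (Suc n) (coeff p) = vec (Suc n) (coeff q)"
      show "coeff p i = coeff q i"
      proof (cases "i \<le> n")
        case True
        thus ?thesis using arg_cong[OF eq, of "\<lambda>v. v $ i"] by simp
      next
        case False
        thus ?thesis using pq by (simp add: toeplitz_kernel_def coeff_eq_0)
      qed
    qed
    have "v \<in> (\<lambda>p. vec (Suc n) (coeff p)) ` toeplitz_kernel ?t n" if v: "v \<in> mat_kernel ?A" for v
    proof -
      define p where "p = Abs_poly (\<lambda>i. if i \<le> n then v $ i else 0)"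
      have cp: "coeff p i = (if i \<le> n then v $ i else 0)" for i
        unfolding p_def by (subst coeff_Abs_poly[of n]) auto
      have "degree p \<le> n"
        by (rule degree_le) (auto simp: cp)
      moreover have "v = vec (Suc n) (coeff p)"
        using v mat_kernel_carrier[OF A] by (intro eq_vecI) (auto simp: cp)
      ultimately show ?thesis using iff v by blast
    qed
    thus "(\<lambda>p. vec (Suc n) (coeff p)) ` toeplitz_kernel ?t n = mat_kernel ?A"
      using iff by (auto simp: toeplitz_kernel_def)
  qed
qed

lemma card_toeplitz_kernel:
  fixes a b :: "nat \<Rightarrow> 'a :: {finite, field}"
  shows "card (toeplitz_kernel (toeplitz_diagonal a b) n) = CARD('a) ^ kernel_dim (toeplitz_mat a b n)"
  using bij_betw_same_card[OF bij_betw_toeplitz_kernel[of n a b]]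
    card_mat_kernel[of "toeplitz_mat a b n" "Suc n" "Suc n"]
  by (simp add: toeplitz_mat_def)

section \<open>Sequences that rise, stay level and fall to zero\<close>

lemma stream_eqI:
  assumes "\<And>n. s !! n = s' !! n"
  shows "s = s'"
proof -
  have "snth s = snth s'" using assms by (rule ext)
  thus ?thesis by (metis stream_smap_nats)
qed

text \<open>The local rules from which the decomposition into strings follows: the sequence can turn
  upwards only at zero, and a fall can stop only there.\<close>

definition rise_level_fall :: "nat stream \<Rightarrow> bool" where
  "rise_level_fall s \<longleftrightarrow>
     s !! 0 \<le> 1
     \<and> (\<forall>n. s !! Suc n \<le> Suc (s !! n))
     \<and> (\<forall>n. s !! n \<le> Suc (s !! Suc n))
     \<and> (\<forall>n. s !! Suc n \<ge> 1 \<longrightarrow> s !! Suc (Suc n) = Suc (s !! Suc n) \<longrightarrow> s !! Suc n = Suc (s !! n))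
     \<and> (\<forall>n. s !! Suc n \<ge> 1 \<longrightarrow> s !! n = Suc (s !! Suc n) \<longrightarrow> s !! Suc n = Suc (s !! Suc (Suc n)))"

text \<open>The zero at the cut makes the next entry at most one, as required of a first entry.\<close>

lemma rise_level_fall_sdrop:
  assumes "rise_level_fall s" "s !! n = 0"
  shows "rise_level_fall (sdrop (Suc n) s)"
proof -
  have "s !! Suc n \<le> 1"
    using assms unfolding rise_level_fall_def by (metis One_nat_def)
  thus ?thesis
    using assms(1) unfolding rise_level_fall_def sdrop_snth by (metis add_Suc_right add_0_right)
qed

text \<open>Here \<open>d\<close> is the height of the plateau and \<open>l\<close> is the position of the first entry of the descent.
  The plateau begins at position \<open>d - 1\<close>, where the rise reaches \<open>d\<close>, so it has \<open>l - (d - 1)\<close> entries.\<close>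

lemma stake_plateau_shape:
  assumes "d \<ge> 1" "d \<le> l"
    and up: "\<And>i. i < d \<Longrightarrow> s !! i = Suc i"
    and flat: "\<And>i. d \<le> i \<Longrightarrow> i < l \<Longrightarrow> s !! i = d"
    and down: "\<And>j. j < d \<Longrightarrow> s !! (l + j) = d - Suc j"
  shows "stake (l + d) s = [1..<d] @ replicate (Suc l - d) d @ rev [0..<d]"
proof (rule nth_equalityI)
  show "length (stake (l + d) s) = length ([1..<d] @ replicate (Suc l - d) d @ rev [0..<d])"
    using assms(1,2) by simp
  fix i assume i: "i < length (stake (l + d) s)"
  consider "i < d - 1" | "i = d - 1" | "d \<le> i" "i < l" | "l \<le> i" by linarith
  thus "stake (l + d) s ! i = ([1..<d] @ replicate (Suc l - d) d @ rev [0..<d]) ! i"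
  proof cases
    case 4
    define j where "j = i - l"
    have "i = l + j" "j < d" using 4 i by (auto simp: j_def)
    moreover have "Suc (l + j) - d = (Suc l - d) + j" "\<not> l + j < d - 1"
      using assms(1,2) by linarith+
    ultimately show ?thesis using assms(1,2) down[of j] by (simp add: nth_append rev_nth)
  qed (use assms(1,2) i up[of i] flat[of i] in \<open>auto simp: nth_append\<close>)
qed

text \<open>Follow the initial rise to its height \<open>d\<close>. If it never ends, the sequence is \<open>1, 2, 3, \<dots>\<close>; if \<open>d = 0\<close>,
  the sequence starts with the string \<open>0\<close>. Otherwise it stays at \<open>d\<close> forever, or there is a first later
  entry different from \<open>d\<close>. That entry is not \<open>d + 1\<close>, because the rise has ended and a plateau is not
  followed by a rise. So it is \<open>d - 1\<close>, and from there the sequence falls to zero, which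
  completes a string. A peak is a plateau of length one.\<close>

lemma first_string_or_tail:
  assumes s: "rise_level_fall s"
  obtains (const) "eventually_const_form s"
  | (grow) "s = fromN 1"
  | (string) x s' where "nullity_string x" "s = x @- s'" "rise_level_fall s'"
proof -
  have s0: "s !! 0 \<le> 1"
    and up1: "\<And>n. s !! Suc n \<le> Suc (s !! n)"
    and down1: "\<And>n. s !! n \<le> Suc (s !! Suc n)"
    and rise_after_rise: "\<And>n. s !! Suc n \<ge> 1 \<Longrightarrow> s !! Suc (Suc n) = Suc (s !! Suc n) \<Longrightarrow> s !! Suc n = Suc (s !! n)"
    and fall_after_fall: "\<And>n. s !! Suc n \<ge> 1 \<Longrightarrow> s !! n = Suc (s !! Suc n) \<Longrightarrow> s !! Suc n = Suc (s !! Suc (Suc n))"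
    using s unfolding rise_level_fall_def by blast+
  show thesis
  proof (cases "\<forall>i. s !! i = Suc i")
    case True
    thus thesis by (intro grow stream_eqI) simp
  next
    case False
    \<comment> \<open>The index of the first deviation from \<open>1, 2, 3, \<dots>\<close> is also the height that the rise reaches.\<close>
    define d where "d = (LEAST i. s !! i \<noteq> Suc i)"
    have d: "s !! d \<noteq> Suc d"
      using False LeastI_ex[of "\<lambda>i. s !! i \<noteq> Suc i"] unfolding d_def by blast
    have up: "s !! i = Suc i" if "i < d" for i
      using that not_less_Least unfolding d_def by blast
    show thesis
    proof (cases "d = 0")
      case True
      have "s !! 0 = 0" using d s0 True by simp
      moreover have "s = [s !! 0] @- stl s" by simp
      moreover have "zero_string [0]"
        unfolding zero_string_def by (rule exI[of _ 1]) simp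
      ultimately show thesis
        using string[of "[0]" "sdrop (Suc 0) s"] rise_level_fall_sdrop[OF s, of 0]
        by (simp add: nullity_string_def)
    next
      case False
      then obtain m where m: "d = Suc m" by (cases d) auto
      have sm: "s !! m = d" using up[of m] m by simp
      show thesis
      proof (cases "\<forall>i\<ge>d. s !! i = d")
        case True
        have "s = [1..<d] @- sconst d"
        proof (rule stream_eqI)
          fix i
          consider "i < m" | "i = m" | "i \<ge> d" using m by linarith
          thus "s !! i = ([1..<d] @- sconst d) !! i"
            by cases (use up[of i] sm m True in \<open>auto simp: shift_snth_less shift_snth_ge simp del: upt_Suc\<close>)
        qed
        moreover have "d \<ge> 1" using False by simp
        ultimately show thesis using const unfolding eventually_const_form_def by blast
      next
        case nconst: False
        define l where "l = (LEAST i. i \<ge> d \<and> s !! i \<noteq> d)"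
        have l: "l \<ge> d" "s !! l \<noteq> d"
          using nconst LeastI_ex[of "\<lambda>i. i \<ge> d \<and> s !! i \<noteq> d"] unfolding l_def by blast+
        have plateau: "s !! i = d" if "d \<le> i" "i < l" for i
          using that not_less_Least[of i "\<lambda>i. i \<ge> d \<and> s !! i \<noteq> d"] unfolding l_def by blast
        obtain k where k: "l = Suc k" using l False by (cases l) auto
        have sk: "s !! k = d"
          using plateau[of k] sm k l m by (cases "k = m") auto
        \<comment> \<open>If the plateau has a single entry, this is the choice of \<open>d\<close>; otherwise the entry
          before the last one of the plateau also equals \<open>d\<close>, so the last one does not end a rise.\<close>
        have not_up: "s !! l \<noteq> Suc d"
        proof
          assume up': "s !! l = Suc d"
          show False
          proof (cases "l = d")
            case True
            thus False using up' d by simp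
          next
            case False
            then obtain j where j: "k = Suc j" using k l m by (cases k) auto
            have "s !! j = d"
              using plateau[of j] sm j k l m False by (cases "j = m") auto
            thus False using rise_after_rise[of j] sk up' k j \<open>d \<noteq> 0\<close> by simp
          qed
        qed
        \<comment> \<open>Each fall needs the previous fall, so both ends of the step are carried along.\<close>
        have "s !! (k + j) = d - j \<and> s !! (l + j) = d - Suc j" if "j < d" for j
          using that
        proof (induction j)
          case 0
          show ?case using l(2) not_up up1[of k] down1[of k] sk k by simp
        next
          case (Suc j)
          hence "s !! (k + j) = d - j" "s !! Suc (k + j) = d - Suc j" using k by simp_all
          moreover have "s !! Suc (k + j) = Suc (s !! Suc (Suc (k + j)))"
            by (rule fall_after_fall) (use calculation Suc.prems in linarith)+
          ultimately show ?case using k by simp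
        qed
        hence down: "s !! (l + j) = d - Suc j" if "j < d" for j using that by blast
        define x where "x = stake (l + d) s"
        have "s !! (l + m) = 0" using down[of m] m by simp
        hence "rise_level_fall (sdrop (l + d) s)"
          using rise_level_fall_sdrop[OF s] m by simp
        moreover have "plateau_string x"
          unfolding plateau_string_def x_def
          using stake_plateau_shape[OF _ l(1) up plateau down] False l
          by (intro exI[of _ d] conjI exI[of _ "Suc l - d"]) auto
        moreover have "s = x @- sdrop (l + d) s"
          unfolding x_def by (rule stake_sdrop[symmetric])
        ultimately show thesis
          using string[of x "sdrop (l + d) s"] by (simp add: nullity_string_def)
      qed
    qed
  qed
qed

lemma flat_unfold_eq:
  assumes "\<And>i. s i = X i @- s (Suc i)" "\<And>i. X i \<noteq> []"
  shows "flat (smap X (fromN i)) = s i"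
proof -
  have "flat (smap X (fromN i)) !! n = s i !! n" for n
  proof (induction n arbitrary: i rule: less_induct)
    case (less n)
    have eq: "flat (smap X (fromN i)) = X i @- flat (smap X (fromN (Suc i)))"
      by (subst flat_unfold) (use assms(2) in auto)
    have "s i !! n = (X i @- s (Suc i)) !! n"
      using assms(1)[of i] by simp
    thus ?case
    proof (cases "n < length (X i)")
      case True
      thus ?thesis using \<open>s i !! n = _\<close> by (simp only: eq shift_snth_less)
    next
      case False
      moreover have "length (X i) > 0" using assms(2) by simp
      ultimately have "n - length (X i) < n" by linarith
      from less[OF this, of "Suc i"] show ?thesis
        using False \<open>s i !! n = _\<close> by (simp add: eq shift_snth_ge less)
    qed
  qed
  thus ?thesis by (rule stream_eqI)
qed

lemma nullity_string_nonempty: "nullity_string x \<Longrightarrow> x \<noteq> []"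
  by (auto simp: nullity_string_def zero_string_def peak_string_def plateau_string_def)

text \<open>Call a sequence finitely decomposable if it consists of finitely many strings followed by a tail.
  Prefixing a string preserves this property, so what remains after removing the first
  string from a sequence without the property is again without it. Such a sequence therefore
  yields strings forever.\<close>

lemma rise_level_fall_decomposition:
  assumes "rise_level_fall \<nu>"
  shows "(\<exists>ss. (\<forall>s \<in> sset ss. nullity_string s) \<and> \<nu> = flat ss)
     \<or> (\<exists>ss \<mu>. (\<forall>s \<in> set ss. nullity_string s)
          \<and> (eventually_const_form \<mu> \<or> \<mu> = fromN 1) \<and> \<nu> = concat ss @- \<mu>)"
proof -
  define fin_decomp where "fin_decomp s \<longleftrightarrow> (\<exists>ss \<mu>. (\<forall>s \<in> set ss. nullity_string s)
          \<and> (eventually_const_form \<mu> \<or> \<mu> = fromN 1) \<and> s = concat ss @- \<mu>)" for s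
  have fin_tail: "fin_decomp s" if "eventually_const_form s \<or> s = fromN 1" for s
    unfolding fin_decomp_def using that by (intro exI[of _ "[]"] exI[of _ s]) simp
  have fin_shift: "fin_decomp (x @- s)" if "nullity_string x" "fin_decomp s" for x s
  proof -
    obtain ss \<mu> where ss: "\<forall>s \<in> set ss. nullity_string s"
      "eventually_const_form \<mu> \<or> \<mu> = fromN 1" "s = concat ss @- \<mu>"
      using \<open>fin_decomp s\<close> unfolding fin_decomp_def by blast
    show ?thesis
      unfolding fin_decomp_def by (rule exI[of _ "x # ss"], rule exI[of _ \<mu>]) (use ss that(1) in simp)
  qed
  have "\<exists>ss. (\<forall>s \<in> sset ss. nullity_string s) \<and> \<nu> = flat ss" if "\<not> fin_decomp \<nu>"
  proof -
    define P where "P s \<longleftrightarrow> rise_level_fall s \<and> \<not> fin_decomp s" for s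
    have "\<forall>s. \<exists>x s'. P s \<longrightarrow> nullity_string x \<and> s = x @- s' \<and> P s'"
    proof
      fix s
      show "\<exists>x s'. P s \<longrightarrow> nullity_string x \<and> s = x @- s' \<and> P s'"
      proof (cases "P s")
        case True
        hence "rise_level_fall s" by (simp add: P_def)
        thus ?thesis
        proof (cases rule: first_string_or_tail)
          case (string x s')
          hence "P s'" using True fin_shift[of x s'] by (auto simp: P_def)
          thus ?thesis using string by blast
        qed (use True fin_tail[of s] in \<open>auto simp: P_def\<close>)
      qed simp
    qed
    then obtain F G where FG: "\<And>s. P s \<Longrightarrow> nullity_string (F s) \<and> s = F s @- G s \<and> P (G s)"
      unfolding choice_iff by blast
    define f where "f n = (G ^^ n) \<nu>" for n
    define X where "X n = F (f n)" for n
    have P: "P (f n)" for n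
      by (induction n) (use assms that FG in \<open>auto simp: f_def P_def\<close>)
    have f: "f 0 = \<nu>" "\<And>n. nullity_string (X n)" "\<And>n. f n = X n @- f (Suc n)"
      using FG[OF P] by (simp_all add: f_def X_def)
    have "\<nu> = flat (smap X nats)"
      using flat_unfold_eq[of f X 0] f(3) nullity_string_nonempty[OF f(2)] unfolding f(1) by blast
    moreover have "\<forall>s \<in> sset (smap X nats). nullity_string s"
      using f(2) by (auto simp: stream.set_map)
    ultimately show ?thesis by blast
  qed
  thus ?thesis unfolding fin_decomp_def by blast
qed

section \<open>Neighbouring Toeplitz kernels\<close>

lemma toeplitz_kernel_zero_top_iff:
  "p \<in> toeplitz_kernel t (Suc n) \<and> coeff p (Suc n) = 0
     \<longleftrightarrow> p \<in> toeplitz_kernel t n \<and> moment t (- int (Suc n)) p = 0"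
proof -
  have "degree p \<le> n" if "degree p \<le> Suc n" "coeff p (Suc n) = 0"
  proof (rule ccontr)
    assume "\<not> degree p \<le> n"
    hence "degree p = Suc n" using that(1) by simp
    thus False using leading_coeff_0_iff[of p] that(2) by auto
  qed
  hence "degree p \<le> Suc n \<and> coeff p (Suc n) = 0 \<longleftrightarrow> degree p \<le> n"
    by (auto simp: coeff_eq_0)
  moreover have "{- int (Suc n)..0} = insert (- int (Suc n)) {- int n..0}"
    by auto
  ultimately show ?thesis
    unfolding toeplitz_kernel_def by auto
qed

lemma toeplitz_kernel_pCons_iff:
  "pCons 0 p \<in> toeplitz_kernel t (Suc n)
     \<longleftrightarrow> p \<in> toeplitz_kernel t n \<and> moment t 1 p = 0"
proof -
  have "(\<forall>k\<in>{- int (Suc n)..0}. moment t (k + 1) p = 0) \<longleftrightarrow> (\<forall>k\<in>{- int n..1}. moment t k p = 0)"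
  proof safe
    fix k assume *: "\<forall>k\<in>{- int (Suc n)..0}. moment t (k + 1) p = 0" "k \<in> {- int n..1}"
    thus "moment t k p = 0" using bspec[OF *(1), of "k - 1"] by simp
  qed auto
  also have "{- int n..1} = insert 1 {- int n..0}"
    by auto
  finally show ?thesis
    unfolding toeplitz_kernel_def by (auto simp: moment_pCons)
qed

text \<open>Every element of \<open>K\<close> could be divided by \<open>x\<close> again and again, which only \<open>0\<close> can.\<close>

lemma subset_pCons_image_imp_eq_0:
  fixes K :: "'a :: zero poly set"
  assumes "K \<subseteq> pCons 0 ` K" "p \<in> K"
  shows "p = 0"
  using assms(2)
proof (induction "degree p" arbitrary: p rule: less_induct)
  case less
  obtain p' where p': "p = pCons 0 p'" "p' \<in> K"
    using subsetD[OF assms(1) less.prems] by (rule imageE)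
  show ?case
  proof (cases "p' = 0")
    case False
    hence "degree p' < degree p" unfolding p'(1) by (simp add: degree_pCons_eq)
    from less.hyps[OF this p'(2)] False show ?thesis by contradiction
  qed (use p' in simp)
qed

locale toeplitz_nullity =
  fixes t :: "int \<Rightarrow> 'a :: {finite, field}" and \<nu> :: "nat \<Rightarrow> nat"
  assumes card_kernel: "card (toeplitz_kernel t n) = CARD('a) ^ \<nu> n"
begin

abbreviation "K \<equiv> toeplitz_kernel t"
text \<open>The elements \<open>p\<close> of \<open>K n\<close> such that \<open>p\<close>, respectively \<open>x p\<close>, lies in \<open>K (n + 1)\<close>. Seen from
  \<open>K (n + 1)\<close>, they account for the elements with vanishing top, respectively constant, coefficient
  (\<open>persisting_eq\<close>, \<open>pCons_shiftable_eq\<close>).\<close>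

abbreviation "persisting n \<equiv> {p \<in> K n. moment t (- int (Suc n)) p = 0}"
abbreviation "shiftable n \<equiv> {p \<in> K n. moment t 1 p = 0}"

lemma two_le_card_field: "2 \<le> CARD('a)"
  using card_mono[of "UNIV :: 'a set" "{0, 1}"] by simp

lemma finite_kernel: "finite (K n)"
  using card_kernel[of n] by (intro card_ge_0_finite) simp

lemma power_card_le_iff: "CARD('a) ^ i \<le> CARD('a) ^ j \<longleftrightarrow> i \<le> j"
  using two_le_card_field by (intro power_increasing_iff) simp

lemma kernel_not_subset_pCons_image:
  assumes "\<nu> n \<ge> 1"
  shows "\<not> K n \<subseteq> pCons 0 ` K n"
proof
  assume "K n \<subseteq> pCons 0 ` K n"
  hence "K n \<subseteq> {0}"
    using subset_pCons_image_imp_eq_0 by blast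
  hence "CARD('a) ^ \<nu> n \<le> CARD('a) ^ 0"
    using card_mono[of "{0}" "K n"] card_kernel by simp
  thus False
    using assms unfolding power_card_le_iff by simp
qed

lemma card_zeros:
  assumes "Vector_Spaces.linear Polynomial.smult (*) \<phi>" "p \<in> K n" "\<phi> p \<noteq> 0"
  shows "\<nu> n \<ge> 1" "card {p \<in> K n. \<phi> p = 0} = CARD('a) ^ (\<nu> n - 1)"
proof -
  let ?Z = "{p \<in> K n. \<phi> p = 0}"
  have eq: "CARD('a) ^ \<nu> n = CARD('a) * card ?Z"
    using card_eq_card_field_times_card_hyperplane[OF assms(1) subspace_toeplitz_kernel finite_kernel assms(2,3)]
      card_kernel by simp
  show "\<nu> n \<ge> 1"
    using eq two_le_card_field by (cases "\<nu> n") auto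
  thus "card ?Z = CARD('a) ^ (\<nu> n - 1)"
    using eq by (cases "\<nu> n") simp_all
qed

lemma card_zeros_ge:
  assumes "Vector_Spaces.linear Polynomial.smult (*) \<phi>"
  shows "CARD('a) ^ (\<nu> n - 1) \<le> card {p \<in> K n. \<phi> p = 0}"
proof (cases "\<exists>p\<in>K n. \<phi> p \<noteq> 0")
  case True
  thus ?thesis using card_zeros(2)[OF assms] by auto
next
  case False
  hence "{p \<in> K n. \<phi> p = 0} = K n" by auto
  thus ?thesis by (simp add: card_kernel power_card_le_iff)
qed

lemma persisting_eq: "persisting n = {p \<in> K (Suc n). coeff p (Suc n) = 0}"
  using toeplitz_kernel_zero_top_iff by blast

lemma pCons_shiftable_eq: "pCons 0 ` shiftable n = {p \<in> K (Suc n). coeff p 0 = 0}"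
proof -
  have "p \<in> pCons 0 ` shiftable n" if "p \<in> K (Suc n)" "coeff p 0 = 0" for p
  proof -
    obtain c p' where "p = pCons c p'" by (cases p)
    thus ?thesis using that toeplitz_kernel_pCons_iff[of p' t n] by auto
  qed
  thus ?thesis
    using toeplitz_kernel_pCons_iff[of _ t n] by auto
qed

lemma card_pCons_image: "card (pCons 0 ` (S :: 'a poly set)) = card S"
  by (rule card_image) (simp add: inj_on_def)

lemma nullity_0_le: "\<nu> 0 \<le> 1"
proof -
  have "K 0 \<subseteq> (\<lambda>c. [:c:]) ` UNIV"
    by (auto simp: toeplitz_kernel_def elim!: degree_eq_zeroE)
  hence "card (K 0) \<le> CARD('a) ^ 1"
    using card_mono[of "(\<lambda>c :: 'a. [:c:]) ` UNIV" "K 0"] card_image_le[of "UNIV :: 'a set" "\<lambda>c. [:c:]"]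
    by simp
  thus ?thesis
    unfolding card_kernel power_card_le_iff .
qed

text \<open>The space \<open>persisting n\<close> is the zero set of one functional on \<open>K n\<close> and also of one functional
  on \<open>K (n + 1)\<close>.\<close>

lemma nullity_step_le: "\<nu> (Suc n) \<le> Suc (\<nu> n)" "\<nu> n \<le> Suc (\<nu> (Suc n))"
proof -
  have "CARD('a) ^ (\<nu> (Suc n) - 1) \<le> card (persisting n)"
    unfolding persisting_eq by (rule card_zeros_ge) (rule linear_coeff)
  also have "\<dots> \<le> CARD('a) ^ \<nu> n"
    unfolding card_kernel[symmetric] by (intro card_mono finite_kernel) auto
  finally show "\<nu> (Suc n) \<le> Suc (\<nu> n)"
    unfolding power_card_le_iff by simp
  have "CARD('a) ^ (\<nu> n - 1) \<le> card (persisting n)"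
    by (rule card_zeros_ge) (rule linear_moment)
  also have "\<dots> \<le> CARD('a) ^ \<nu> (Suc n)"
    unfolding card_kernel[symmetric] persisting_eq by (intro card_mono finite_kernel) auto
  finally show "\<nu> n \<le> Suc (\<nu> (Suc n))"
    unfolding power_card_le_iff by simp
qed

lemma moment_eq_0: "p \<in> K n \<Longrightarrow> - int n \<le> k \<Longrightarrow> k \<le> 0 \<Longrightarrow> moment t k p = 0"
  by (simp add: toeplitz_kernel_def)

lemma degree_kernel_le: "p \<in> K n \<Longrightarrow> degree p \<le> n"
  by (simp add: toeplitz_kernel_def)

text \<open>Let \<open>N = n + 1\<close>. Since \<open>K (N + 1)\<close> is larger than \<open>K N\<close>, both \<open>K N\<close> and \<open>x K N\<close> lie in it, as the
  hyperplanes of vanishing top and vanishing constant coefficient. If all elements of \<open>K N\<close> had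
  vanishing top coefficient, \<open>x K N\<close> would lie in \<open>K N\<close>; if all had vanishing constant
  coefficient, \<open>K N\<close> would lie in \<open>x K N\<close>; neither is possible. An element \<open>w\<close> of \<open>K N\<close> with nonzero constant
  coefficient, paired with \<open>p\<close> in \<open>K n\<close>, forces the one moment that keeps \<open>p\<close> from
  being in \<open>K N\<close> to vanish. So \<open>K n\<close> is the zero set in \<open>K N\<close> of the top coefficient, which is
  not zero on \<open>K N\<close>.\<close>

lemma growth_persists_backwards:
  assumes pos: "\<nu> (Suc n) \<ge> 1" and up: "\<nu> (Suc (Suc n)) = Suc (\<nu> (Suc n))"
  shows "\<nu> (Suc n) = Suc (\<nu> n)"
proof -
  let ?N = "Suc n"
  have stay: "persisting ?N = K ?N"
  proof (rule card_seteq[OF finite_kernel])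
    show "card (K ?N) \<le> card (persisting ?N)"
      using card_zeros_ge[OF linear_coeff, of "Suc ?N" "Suc ?N"] up
      unfolding persisting_eq card_kernel by simp
  qed auto
  have shift: "shiftable ?N = K ?N"
  proof (rule card_seteq[OF finite_kernel])
    show "card (K ?N) \<le> card (shiftable ?N)"
      using card_zeros_ge[OF linear_coeff, of "Suc ?N" 0] up
      unfolding card_kernel card_pCons_image[of "shiftable ?N", symmetric] pCons_shiftable_eq by simp
  qed auto
  obtain v where v: "v \<in> K ?N" "coeff v ?N \<noteq> 0"
  proof (rule ccontr)
    assume *: "\<not> thesis"
    have "pCons 0 ` K ?N \<subseteq> K ?N"
    proof
      fix p assume "p \<in> pCons 0 ` K ?N"
      then obtain p' where p': "p = pCons 0 p'" "p' \<in> K ?N" by auto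
      have "p \<in> K (Suc ?N)"
        using p' pCons_shiftable_eq[of ?N] unfolding shift by auto
      moreover have "coeff p (Suc ?N) = 0"
        using p' * that by auto
      ultimately have "p \<in> persisting ?N"
        unfolding persisting_eq by simp
      thus "p \<in> K ?N" by simp
    qed
    hence "pCons 0 ` K ?N = K ?N"
      by (intro card_subset_eq finite_kernel card_pCons_image)
    thus False
      using kernel_not_subset_pCons_image[OF pos] by simp
  qed
  obtain w where w: "w \<in> K ?N" "coeff w 0 \<noteq> 0"
  proof (rule ccontr)
    assume *: "\<not> thesis"
    have "K ?N \<subseteq> pCons 0 ` shiftable ?N"
      unfolding pCons_shiftable_eq using * that stay persisting_eq[of ?N] by blast
    thus False
      using kernel_not_subset_pCons_image[OF pos] unfolding shift by simp
  qed
  have "moment t (- int ?N) p = 0" if p: "p \<in> K n" for p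
  proof -
    have "coeff w 0 * moment t (- int ?N) p
        = (\<Sum>i\<le>?N. coeff w i * moment t (int i + - int ?N) p)"
      by (subst sum.atMost_Suc_shift) (use moment_eq_0[OF p] in auto)
    also have "\<dots> = (\<Sum>j\<le>n. coeff p j * moment t (int j + - int ?N) w)"
      by (rule moment_pairing_commute) (use w p degree_kernel_le in auto)
    also have "\<dots> = 0"
      by (rule sum.neutral) (use moment_eq_0[OF w(1)] in auto)
    finally show ?thesis using w by simp
  qed
  hence "persisting n = K n" by blast
  hence "CARD('a) ^ \<nu> n = CARD('a) ^ (\<nu> ?N - 1)"
    using card_zeros(2)[OF linear_coeff v] unfolding persisting_eq card_kernel by (metis card_kernel)
  hence "\<nu> n = \<nu> ?N - 1"
    using two_le_card_field by (simp add: power_inject_exp)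
  thus ?thesis using pos by simp
qed

text \<open>Let \<open>N = n + 1\<close>. Since \<open>K N\<close> is smaller than \<open>K n\<close>, it coincides with \<open>persisting n\<close> and with
  \<open>x\<close> times \<open>shiftable n\<close>. These are two different hyperplanes of \<open>K n\<close>, for otherwise \<open>K N\<close> would be
  \<open>x K N\<close>. Pairing \<open>u\<close> in \<open>K (N + 1)\<close> with \<open>z\<close> in \<open>K n\<close> leaves only the two end coefficients of \<open>u\<close>,
  multiplied with the functionals on \<open>z\<close> that define these hyperplanes. Choosing \<open>z\<close>
  in one hyperplane but not in the other shows that both end coefficients vanish, so
  \<open>K (N + 1)\<close> is contained in \<open>K N\<close> and in \<open>x K N\<close>. If it were all of \<open>K N\<close>, then \<open>K N\<close> would be
  contained in \<open>x K N\<close>.\<close>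

lemma descent_persists:
  assumes pos: "\<nu> (Suc n) \<ge> 1" and down: "\<nu> n = Suc (\<nu> (Suc n))"
  shows "\<nu> (Suc n) = Suc (\<nu> (Suc (Suc n)))"
proof -
  let ?N = "Suc n"
  have stay: "persisting n = K ?N"
  proof (rule card_seteq[OF finite_kernel])
    show "persisting n \<subseteq> K ?N" unfolding persisting_eq by auto
    show "card (K ?N) \<le> card (persisting n)"
      using card_zeros_ge[OF linear_moment[of t "- int (Suc n)"], of n] down unfolding card_kernel by simp
  qed
  have shift: "pCons 0 ` shiftable n = K ?N"
  proof (rule card_seteq[OF finite_kernel])
    show "pCons 0 ` shiftable n \<subseteq> K ?N" unfolding pCons_shiftable_eq by auto
    show "card (K ?N) \<le> card (pCons 0 ` shiftable n)"
      using card_zeros_ge[OF linear_moment[of t 1], of n] down unfolding card_kernel card_pCons_image by simp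
  qed
  have neq: "persisting n \<noteq> shiftable n"
    using kernel_not_subset_pCons_image[OF pos] stay shift by auto
  have card_eq: "card (persisting n) = card (shiftable n)"
    using stay shift card_pCons_image[of "shiftable n"] by simp
  have fin: "finite (persisting n)" "finite (shiftable n)"
    using finite_kernel[of n] by auto
  obtain y where y: "y \<in> K n" "moment t (- int ?N) y = 0" "moment t 1 y \<noteq> 0"
    using neq card_eq fin card_subset_eq[of "shiftable n" "persisting n"] by auto
  obtain y' where y': "y' \<in> K n" "moment t (- int ?N) y' \<noteq> 0" "moment t 1 y' = 0"
    using neq card_eq fin card_subset_eq[of "persisting n" "shiftable n"] by auto
  have ends: "coeff u 0 * moment t (- int ?N) z + coeff u (Suc ?N) * moment t 1 z = 0"
    if u: "u \<in> K (Suc ?N)" and z: "z \<in> K n" for u z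
  proof -
    have "0 = (\<Sum>i\<le>n. coeff z i * moment t (int i + - int ?N) u)"
      by (rule sum.neutral[symmetric]) (use moment_eq_0[OF u] in auto)
    also have "\<dots> = (\<Sum>j\<le>Suc ?N. coeff u j * moment t (int j + - int ?N) z)"
      by (rule moment_pairing_commute) (use u z degree_kernel_le in auto)
    also have "\<dots> = coeff u 0 * moment t (- int ?N) z
        + (\<Sum>j\<le>n. coeff u (Suc j) * moment t (int j - int n) z) + coeff u (Suc ?N) * moment t 1 z"
      by (subst sum.atMost_Suc, subst sum.atMost_Suc_shift) simp
    also have "(\<Sum>j\<le>n. coeff u (Suc j) * moment t (int j - int n) z) = 0"
      by (rule sum.neutral) (use moment_eq_0[OF z] in auto)
    finally show ?thesis by simp
  qed
  have sub1: "K (Suc ?N) \<subseteq> K ?N"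
  proof
    fix u assume u: "u \<in> K (Suc ?N)"
    hence "u \<in> persisting ?N"
      using ends[OF u y(1)] y unfolding persisting_eq by simp
    thus "u \<in> K ?N" by simp
  qed
  have sub2: "K (Suc ?N) \<subseteq> pCons 0 ` K ?N"
  proof
    fix u assume u: "u \<in> K (Suc ?N)"
    hence "u \<in> pCons 0 ` shiftable ?N"
      using ends[OF u y'(1)] y' unfolding pCons_shiftable_eq by simp
    thus "u \<in> pCons 0 ` K ?N" by auto
  qed
  have "\<not> \<nu> ?N \<le> \<nu> (Suc ?N)"
  proof
    assume "\<nu> ?N \<le> \<nu> (Suc ?N)"
    hence "K (Suc ?N) = K ?N"
      using sub1 by (intro card_seteq finite_kernel) (simp_all add: card_kernel power_card_le_iff)
    thus False
      using sub2 kernel_not_subset_pCons_image[OF pos] by simp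
  qed
  thus ?thesis
    using nullity_step_le(2)[of ?N] by simp
qed

lemma rise_level_fall_nullity: "rise_level_fall (smap \<nu> nats)"
proof -
  have snth: "smap \<nu> nats !! n = \<nu> n" for n by simp
  show ?thesis
    unfolding rise_level_fall_def snth
    using nullity_0_le nullity_step_le growth_persists_backwards descent_persists by blast
qed

end

section \<open>The possible nullity sequences\<close>

theorem theorem1:
  fixes a b :: "nat \<Rightarrow> 'a :: {finite, field}"
    and \<nu> :: "nat stream"
  assumes "\<nu> = nullity_seq a b"
  shows
    "eventually_const_form \<nu>
     \<or> \<nu> = fromN 0
     \<or> \<nu> = fromN 1
     \<or> (\<exists>ss. (\<forall>s \<in> sset ss. nullity_string s) \<and> \<nu> = flat ss)
     \<or> (\<exists>ss \<mu>. (\<forall>s \<in> set ss. nullity_string s)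
          \<and> (eventually_const_form \<mu> \<or> \<mu> = fromN 1)
          \<and> \<nu> = concat ss @- \<mu>)"
proof -
  interpret toeplitz_nullity "toeplitz_diagonal a b" "\<lambda>n. kernel_dim (toeplitz_mat a b n)"
    by unfold_locales (rule card_toeplitz_kernel)
  have "rise_level_fall \<nu>"
    using rise_level_fall_nullity assms by (simp add: nullity_seq_def)
  thus ?thesis
    by (intro disjI2 rise_level_fall_decomposition)
qed

end
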